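(* For a positive integer $n$, let $N(2n)$ be the number of distinct $S(3,\{4,6\},2n)$ designs on a fixed $2n$-element point set. There is a constant $c>0$ such that $\ln N(2n)> c\, n^3\ln n$ for all sufficiently large $n$.
   Context: An $S(3,\{4,6\},v)$ is a pair $(X,B)$ with $|X|=v$ and $B$ a set of subsets of $X$ each of size $4$ or $6$, such that every $3$-element subset of $X$ is contained in exactly one member of $B$. *)

theory Defs
  imports Complex_Main
begin

definition is_S3_46 :: "'a set \<Rightarrow> 'a set set \<Rightarrow> bool" where
  "is_S3_46 X B \<longleftrightarrow>
     (\<forall>b\<in>B. b \<subseteq> X \<and> (card b = 4 \<or> card b = 6)) \<and>
     (\<forall>T. T \<subseteq> X \<and> card T = 3 \<longrightarrow> (\<exists>!b. b \<in> B \<and> T \<subseteq> b))"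

definition num_S3_46 :: "nat \<Rightarrow> nat" where
  "num_S3_46 v = card {B. is_S3_46 {0..<v} B}"

end

theory Submission
  imports Defs
begin

text \<open>
  Every design on \<open>u\<close> points yields one on \<open>2 * u\<close> points and, by deleting a point first, one on
  \<open>2 * u - 2\<close> points: each point is doubled, each block is replaced by an H-design whose groups are
  the doubled points of the block, and the triples containing a doubled point are covered by small
  designs. For even \<open>u\<close> this reaches all even orders. The H-design on a doubled block of size 4
  consists of the transversals of even parity, so iterating the constructions from a single block
  of size 4 produces, for some \<open>m = 2 ^ e\<close> with \<open>4 * m < v \<le> 12 * m\<close>, a design on \<open>v\<close> points that
  contains the \<open>m ^ 3\<close> quadruples \<open>{p, q, r, xor p (xor q r)}\<close> with \<open>p < m \<le> q < 2 * m \<le> r < 3 * m\<close>.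

  For \<open>0 < c < m\<close>, the eight such quadruples with \<open>p\<close>, \<open>q\<close>, \<open>r\<close> varying in fixed pairs
  \<open>{x, xor c x}\<close> cover the same triples as the eight quadruples
  \<open>{p, q, r, xor c (xor p (xor q r))}\<close>, by which they can be replaced. There are about \<open>m ^ 4 / 8\<close>
  of these trades, each has a block in common with at most \<open>8 * (m - 1)\<close> of them, and trades without
  common blocks are independent of each other. Choosing \<open>m ^ 3 div 128\<close> of them greedily therefore
  gives at least \<open>m ^ (m ^ 3 div 128)\<close> different designs.
\<close>

subsection \<open>H-designs\<close>

definition H_design :: "('a \<Rightarrow> 'b) \<Rightarrow> 'a set \<Rightarrow> 'a set set \<Rightarrow> bool" where
  "H_design \<pi> X B \<longleftrightarrow>
     (\<forall>b\<in>B. b \<subseteq> X \<and> (card b = 4 \<or> card b = 6) \<and> inj_on \<pi> b) \<and>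
     (\<forall>T. T \<subseteq> X \<and> card T = 3 \<and> inj_on \<pi> T \<longrightarrow> (\<exists>!b. b \<in> B \<and> T \<subseteq> b))"

lemma H_designI:
  assumes "\<And>b. b \<in> B \<Longrightarrow> b \<subseteq> X" "\<And>b. b \<in> B \<Longrightarrow> card b = 4 \<or> card b = 6"
    and "\<And>b. b \<in> B \<Longrightarrow> inj_on \<pi> b"
    and "\<And>T. T \<subseteq> X \<Longrightarrow> card T = 3 \<Longrightarrow> inj_on \<pi> T \<Longrightarrow> \<exists>!b. b \<in> B \<and> T \<subseteq> b"
  shows "H_design \<pi> X B"
  using assms by (simp add: H_design_def)

lemma
  assumes "H_design \<pi> X B"
  shows H_design_block_subset: "b \<in> B \<Longrightarrow> b \<subseteq> X"
    and H_design_block_card: "b \<in> B \<Longrightarrow> card b = 4 \<or> card b = 6"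
    and H_design_block_inj_on: "b \<in> B \<Longrightarrow> inj_on \<pi> b"
    and H_design_ex1: "T \<subseteq> X \<Longrightarrow> card T = 3 \<Longrightarrow> inj_on \<pi> T \<Longrightarrow> \<exists>!b. b \<in> B \<and> T \<subseteq> b"
  using assms unfolding H_design_def by (blast, blast, blast, simp)

lemma is_S3_46_iff_H_design: "is_S3_46 X B \<longleftrightarrow> H_design id X B"
  by (simp add: is_S3_46_def H_design_def)

lemma is_S3_46I:
  assumes "\<And>b. b \<in> B \<Longrightarrow> b \<subseteq> X" "\<And>b. b \<in> B \<Longrightarrow> card b = 4 \<or> card b = 6"
    and "\<And>T. T \<subseteq> X \<Longrightarrow> card T = 3 \<Longrightarrow> \<exists>!b. b \<in> B \<and> T \<subseteq> b"
  shows "is_S3_46 X B"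
  using assms by (simp add: is_S3_46_def)

lemma
  assumes "is_S3_46 X B"
  shows is_S3_46_block_subset: "b \<in> B \<Longrightarrow> b \<subseteq> X"
    and is_S3_46_block_card: "b \<in> B \<Longrightarrow> card b = 4 \<or> card b = 6"
    and is_S3_46_ex1: "T \<subseteq> X \<Longrightarrow> card T = 3 \<Longrightarrow> \<exists>!b. b \<in> B \<and> T \<subseteq> b"
  using assms unfolding is_S3_46_def by (blast, blast, simp)

lemma is_S3_46_unique:
  assumes "is_S3_46 X B" "a \<in> B" "b \<in> B" "T \<subseteq> a" "T \<subseteq> b" "card T = 3"
  shows "a = b"
proof -
  have "T \<subseteq> X" using is_S3_46_block_subset[OF assms(1,2)] assms(4) by simp
  then show ?thesis using is_S3_46_ex1[OF assms(1)] assms(2-) by metis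
qed

lemma finite_is_S3_46: "finite X \<Longrightarrow> finite {B. is_S3_46 X B}"
  by (rule finite_subset[of _ "Pow (Pow X)"]) (auto dest: is_S3_46_block_subset)

lemma is_S3_46_singleton: "card X = 4 \<or> card X = 6 \<Longrightarrow> is_S3_46 X {X}"
  unfolding is_S3_46_def by auto

lemma ex1_image:
  assumes "\<exists>!x. x \<in> A \<and> P x" "\<And>x. x \<in> A \<Longrightarrow> Q (f x) \<longleftrightarrow> P x"
  shows "\<exists>!y. y \<in> f ` A \<and> Q y"
proof -
  obtain x where x: "x \<in> A" "P x" "\<And>y. y \<in> A \<Longrightarrow> P y \<Longrightarrow> y = x" using assms(1) by blast
  show ?thesis
  proof (rule ex1I[of _ "f x"])
    show "f x \<in> f ` A \<and> Q (f x)" using x(1,2) assms(2) by blast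
    show "y = f x" if "y \<in> f ` A \<and> Q y" for y using that x(3) assms(2) by blast
  qed
qed

lemma ex1_UN:
  assumes "\<exists>!i. P i" "\<And>i. P i \<Longrightarrow> i \<in> I" "\<And>i. P i \<Longrightarrow> \<exists>!x. x \<in> A i \<and> Q x"
    and "\<And>i x. i \<in> I \<Longrightarrow> x \<in> A i \<Longrightarrow> Q x \<Longrightarrow> P i"
  shows "\<exists>!x. x \<in> \<Union>(A ` I) \<and> Q x"
proof -
  obtain i where i: "P i" and unique: "\<And>i'. P i' \<Longrightarrow> i' = i" using assms(1) by blast
  have "x \<in> \<Union>(A ` I) \<and> Q x \<longleftrightarrow> x \<in> A i \<and> Q x" for x
    using assms(2)[OF i] assms(4) unique by blast
  then show ?thesis using assms(3)[OF i] by simp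
qed

lemma H_design_image:
  assumes B: "H_design \<pi> X B" and f: "bij_betw f X Y"
    and \<rho>: "\<And>x y. x \<in> X \<Longrightarrow> y \<in> X \<Longrightarrow> \<rho> (f x) = \<rho> (f y) \<longleftrightarrow> \<pi> x = \<pi> y"
  shows "H_design \<rho> Y ((`) f ` B)"
proof (rule H_designI)
  have inj: "inj_on f X" and Y: "Y = f ` X" using f by (auto simp: bij_betw_def)
  have inj_on_iff: "inj_on \<rho> (f ` T) \<longleftrightarrow> inj_on \<pi> T" if "T \<subseteq> X" for T
  proof -
    have "inj_on (\<rho> \<circ> f) T \<longleftrightarrow> inj_on \<pi> T"
      unfolding inj_on_def using that \<rho> by (metis comp_apply subsetD)
    then show ?thesis using comp_inj_on_iff[OF inj_on_subset[OF inj that]] by metis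
  qed
  have card_eq: "card (f ` T) = card T" if "T \<subseteq> X" for T
    using inj_on_subset[OF inj that] by (rule card_image)
  {
    fix c assume "c \<in> (`) f ` B"
    then obtain b where b: "b \<in> B" "c = f ` b" by blast
    have bX: "b \<subseteq> X" by (rule H_design_block_subset[OF B b(1)])
    show "c \<subseteq> Y" using bX b(2) Y by blast
    show "card c = 4 \<or> card c = 6" "inj_on \<rho> c"
      using H_design_block_card[OF B b(1)] H_design_block_inj_on[OF B b(1)]
      by (simp_all add: b(2) card_eq[OF bX] inj_on_iff[OF bX])
  }
  fix T' assume T': "T' \<subseteq> Y" "card T' = 3" "inj_on \<rho> T'"
  then obtain T where T: "T \<subseteq> X" "T' = f ` T" unfolding Y by (auto simp: subset_image_iff)
  then have "\<exists>!b. b \<in> B \<and> T \<subseteq> b"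
    using T' by (intro H_design_ex1[OF B]) (simp_all add: card_eq inj_on_iff)
  moreover have "T' \<subseteq> f ` b \<longleftrightarrow> T \<subseteq> b" if "b \<in> B" for b
    using inj_on_image_mem_iff[OF inj _ H_design_block_subset[OF B that]] T by blast
  ultimately show "\<exists>!c. c \<in> (`) f ` B \<and> T' \<subseteq> c" by (rule ex1_image)
qed

definition H_design_lists :: "(nat \<Rightarrow> 'b) \<Rightarrow> nat \<Rightarrow> nat list list \<Rightarrow> bool" where
  "H_design_lists \<pi> v ls \<longleftrightarrow>
     (\<forall>l\<in>set ls. (length l = 4 \<or> length l = 6) \<and> (\<forall>x\<in>set l. x < v) \<and> distinct (map \<pi> l)) \<and>
     (\<forall>z\<in>set [0..<v]. \<forall>y\<in>set [0..<z]. \<forall>x\<in>set [0..<y]. distinct [\<pi> x, \<pi> y, \<pi> z] \<longrightarrow>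
       length (filter (\<lambda>l. x \<in> set l \<and> y \<in> set l \<and> z \<in> set l) ls) = 1)"

lemma ex1_if_length_filter_eq_1:
  assumes "length (filter P xs) = 1"
  shows "\<exists>!x. x \<in> set xs \<and> P x"
proof -
  obtain x where "filter P xs = [x]" using assms by (auto simp: length_Suc_conv)
  then have "{y \<in> set xs. P y} = {x}" by (metis set_filter list.set(1,2))
  then show ?thesis by (simp add: set_eq_iff)
qed

lemma card_3_less_obtain:
  fixes T :: "'a::linorder set"
  assumes "card T = 3"
  obtains x y z where "T = {x, y, z}" "x < y" "y < z"
proof -
  have "finite T" using assms by (metis card.infinite zero_neq_numeral)
  have "length (sorted_list_of_set T) = Suc (Suc (Suc 0))" using assms by simp
  then obtain x y z where "sorted_list_of_set T = [x, y, z]"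
    by (auto simp: length_Suc_conv simp del: length_sorted_list_of_set)
  then have "T = {x, y, z}" "x < y" "y < z"
    using set_sorted_list_of_set[OF \<open>finite T\<close>] strict_sorted_list_of_set[of T] by auto
  then show thesis by (rule that)
qed

lemma H_design_if_lists:
  assumes "H_design_lists \<pi> v ls"
  shows "H_design \<pi> {0..<v} (set ` set ls)"
proof (rule H_designI)
  have blocks: "\<forall>l\<in>set ls. (length l = 4 \<or> length l = 6) \<and> (\<forall>x\<in>set l. x < v) \<and> distinct (map \<pi> l)"
    and triples: "\<And>x y z. x < y \<Longrightarrow> y < z \<Longrightarrow> z < v \<Longrightarrow> distinct [\<pi> x, \<pi> y, \<pi> z] \<Longrightarrow>
       length (filter (\<lambda>l. x \<in> set l \<and> y \<in> set l \<and> z \<in> set l) ls) = 1"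
    using assms unfolding H_design_lists_def by (blast, simp)
  {
    fix b assume "b \<in> set ` set ls"
    then show "b \<subseteq> {0..<v}" "card b = 4 \<or> card b = 6" "inj_on \<pi> b"
      using blocks by (auto simp: distinct_map distinct_card)
  }
  fix T assume T: "T \<subseteq> {0..<v}" "card T = 3" "inj_on \<pi> T"
  then obtain x y z where xyz: "T = {x, y, z}" "x < y" "y < z" using card_3_less_obtain by blast
  have "distinct [\<pi> x, \<pi> y, \<pi> z]" using T(3) xyz by (auto dest: inj_onD)
  then have "\<exists>!l. l \<in> set ls \<and> x \<in> set l \<and> y \<in> set l \<and> z \<in> set l"
    using T(1) xyz by (intro ex1_if_length_filter_eq_1 triples) simp_all
  then show "\<exists>!b. b \<in> set ` set ls \<and> T \<subseteq> b" by (rule ex1_image) (simp add: xyz(1))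
qed

subsection \<open>Doubling the points\<close>

lemma card_image_eq_2_if_fibres_2:
  assumes fibre: "\<And>y. card (\<pi> -` {y}) = 2" and T: "card T = 3" "\<not> inj_on \<pi> T"
  shows "card (\<pi> ` T) = 2"
proof -
  have "finite T" using T(1) by (metis card.infinite zero_neq_numeral)
  have finite_fibre: "finite (\<pi> -` {y})" for y
    using fibre[of y] by (metis card.infinite zero_neq_numeral)
  have "card T \<le> card (\<Union>y\<in>\<pi> ` T. \<pi> -` {y})"
    using \<open>finite T\<close> finite_fibre by (intro card_mono) auto
  also have "\<dots> \<le> (\<Sum>y\<in>\<pi> ` T. card (\<pi> -` {y}))"
    using \<open>finite T\<close> by (intro card_UN_le) simp
  finally have "3 \<le> 2 * card (\<pi> ` T)" by (simp add: fibre T(1))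
  moreover have "card (\<pi> ` T) \<noteq> 3"
    using T \<open>finite T\<close> by (metis eq_card_imp_inj_on)
  moreover have "card (\<pi> ` T) \<le> 3" using T(1) \<open>finite T\<close> by (metis card_image_le)
  ultimately show ?thesis by linarith
qed

text \<open>
  A triple meeting three fibres projects to a triple of \<open>Y\<close>, and one containing a whole fibre
  projects to a pair; so triples of \<open>Y\<close> must be covered by \<open>B \<union> C\<close>, pairs by \<open>C\<close> alone.
\<close>

lemma is_S3_46_vimage:
  assumes fibre: "\<And>y. card (\<pi> -` {y}) = 2"
    and subset: "\<Union>(B \<union> C) \<subseteq> Y"
    and pairs: "\<And>P. P \<subseteq> Y \<Longrightarrow> card P = 2 \<Longrightarrow> \<exists>!c. c \<in> C \<and> P \<subseteq> c"
    and triples: "\<And>T. T \<subseteq> Y \<Longrightarrow> card T = 3 \<Longrightarrow> \<exists>!b. b \<in> B \<union> C \<and> T \<subseteq> b"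
    and H: "\<And>b. b \<in> B \<Longrightarrow> H_design \<pi> (\<pi> -` b) (E b)"
    and S: "\<And>c. c \<in> C \<Longrightarrow> is_S3_46 (\<pi> -` c) (E c)"
  shows "is_S3_46 (\<pi> -` Y) (\<Union>(E ` (B \<union> C)))"
proof (rule is_S3_46I)
  have block: "h \<subseteq> \<pi> -` b" "card h = 4 \<or> card h = 6" if "b \<in> B \<union> C" "h \<in> E b" for b h
    using that H_design_block_subset[OF H] is_S3_46_block_subset[OF S]
      H_design_block_card[OF H] is_S3_46_block_card[OF S] by (blast, blast)
  {
    fix h assume "h \<in> \<Union>(E ` (B \<union> C))"
    then obtain b where b: "b \<in> B \<union> C" "h \<in> E b" by blast
    show "h \<subseteq> \<pi> -` Y" using block(1)[OF b] subset b(1) by blast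
    show "card h = 4 \<or> card h = 6" by (rule block(2)[OF b])
  }
  fix T assume T: "T \<subseteq> \<pi> -` Y" "card T = 3"
  then have "\<pi> ` T \<subseteq> Y" by blast
  define covers where
    "covers b \<longleftrightarrow> b \<in> B \<union> C \<and> (b \<in> C \<or> inj_on \<pi> T) \<and> \<pi> ` T \<subseteq> b" for b
  have "\<exists>!b. covers b"
  proof (cases "inj_on \<pi> T")
    case True
    then have "card (\<pi> ` T) = 3" using T(2) by (simp add: card_image)
    from triples[OF \<open>\<pi> ` T \<subseteq> Y\<close> this] show ?thesis using True by (simp add: covers_def)
  next
    case False
    then have "card (\<pi> ` T) = 2" using fibre T(2) by (intro card_image_eq_2_if_fibres_2)
    moreover have "covers c \<longleftrightarrow> c \<in> C \<and> \<pi> ` T \<subseteq> c" for c using False by (auto simp: covers_def)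
    ultimately show ?thesis using pairs[OF \<open>\<pi> ` T \<subseteq> Y\<close>] by simp
  qed
  moreover have "b \<in> B \<union> C" if "covers b" for b using that by (simp add: covers_def)
  moreover have "\<exists>!h. h \<in> E b \<and> T \<subseteq> h" if b: "covers b" for b
  proof (cases "b \<in> C")
    case True
    then show ?thesis using b T(2) by (intro is_S3_46_ex1[OF S]) (auto simp: covers_def)
  next
    case False
    then show ?thesis using b T(2) by (intro H_design_ex1[OF H]) (auto simp: covers_def)
  qed
  moreover have "covers b" if "b \<in> B \<union> C" "h \<in> E b" "T \<subseteq> h" for b h
  proof -
    have "\<pi> ` T \<subseteq> b" using block(1)[OF that(1,2)] that(3) by blast
    moreover have "inj_on \<pi> T" if "b \<in> B"
      using H_design_block_inj_on[OF H[OF that] \<open>h \<in> E b\<close>] \<open>T \<subseteq> h\<close> by (rule inj_on_subset)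
    ultimately show ?thesis using that(1) by (auto simp: covers_def)
  qed
  ultimately show "\<exists>!h. h \<in> \<Union>(E ` (B \<union> C)) \<and> T \<subseteq> h" by (rule ex1_UN)
qed

abbreviation half :: "nat \<Rightarrow> nat" where
  "half p \<equiv> p div 2"

abbreviation dbl :: "nat set \<Rightarrow> nat set" where
  "dbl c \<equiv> half -` c"

definition map_half :: "(nat \<Rightarrow> nat) \<Rightarrow> nat \<Rightarrow> nat" where
  "map_half f p = 2 * f (half p) + p mod 2"

lemma dbl_atLeastLessThan: "dbl {0..<u} = {0..<2 * u}"
  by auto

lemma half_map_half: "half (map_half f p) = f (half p)"
  by (simp add: map_half_def)

lemma bij_betw_map_half:
  assumes "bij_betw f b c"
  shows "bij_betw (map_half f) (dbl b) (dbl c)"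
proof (rule bij_betw_byWitness)
  have inverse: "map_half h (map_half g p) = p" if "h (g (half p)) = half p" for g h p
    using that by (simp add: map_half_def)
  show "\<forall>p\<in>dbl b. map_half (inv_into b f) (map_half f p) = p"
    using assms by (simp add: inverse bij_betw_inv_into_left)
  show "\<forall>q\<in>dbl c. map_half f (map_half (inv_into b f) q) = q"
    using assms by (simp add: inverse bij_betw_inv_into_right)
  show "map_half f ` dbl b \<subseteq> dbl c"
    using bij_betw_imp_surj_on[OF assms] by (auto simp: half_map_half)
  show "map_half (inv_into b f) ` dbl c \<subseteq> dbl b"
    using bij_betw_imp_surj_on[OF bij_betw_inv_into[OF assms]] by (auto simp: half_map_half)
qed

lemma card_dbl:
  assumes "finite c"
  shows "card (dbl c) = 2 * card c"
proof -
  obtain f where "bij_betw f {0..<card c} c" using ex_bij_betw_nat_finite[OF assms] by blast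
  from bij_betw_same_card[OF bij_betw_map_half[OF this]] show ?thesis
    by (simp add: dbl_atLeastLessThan)
qed

subsection \<open>Designs on doubled blocks\<close>

text \<open>
  The orbits of \<open>{0, 1, 3, 4}\<close>, \<open>{0, 1, 2, 6}\<close> and \<open>{0, 2, 4, 7}\<close> under translation modulo 10,
  after the relabelling \<open>2 \<mapsto> 4 \<mapsto> 3 \<mapsto> 2\<close>, which turns the first block into \<open>{0, 1, 2, 3}\<close>.
\<close>

definition sqs10 :: "nat list list" where
  "sqs10 = [[0, 1, 2, 3], [0, 1, 4, 6], [0, 1, 5, 9], [0, 1, 7, 8], [0, 2, 4, 9], [0, 2, 5, 7],
    [0, 2, 6, 8], [0, 3, 4, 7], [0, 3, 5, 6], [0, 3, 8, 9], [0, 4, 5, 8], [0, 6, 7, 9],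
    [1, 2, 4, 7], [1, 2, 5, 8], [1, 2, 6, 9], [1, 3, 4, 5], [1, 3, 6, 8], [1, 3, 7, 9],
    [1, 4, 8, 9], [1, 5, 6, 7], [2, 3, 4, 8], [2, 3, 5, 9], [2, 3, 6, 7], [2, 4, 5, 6],
    [2, 7, 8, 9], [3, 4, 6, 9], [3, 5, 7, 8], [4, 5, 7, 9], [4, 6, 7, 8], [5, 6, 8, 9]]"

lemma is_S3_46_sqs10: "is_S3_46 {0..<10} (set ` set sqs10)"
  unfolding is_S3_46_iff_H_design by (rule H_design_if_lists) code_simp

text \<open>
  Encode a transversal of the pairs \<open>{2 * y, 2 * y + 1}\<close> as a partial 0-1 labelling of 6 points. The
  two blocks of size 6 are the constant labellings and cover the constant triples. For the others
  take a one-factorization of the complete graph on 6 points: two distinct edges of one factor,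
  labelled 0 and 1 respectively, form a block, and there are 5 * 6 of these.
\<close>

definition td6 :: "nat list list" where
  "td6 = [[0, 2, 4, 6, 8, 10], [1, 3, 5, 7, 9, 11],
    [0, 3, 9, 10], [0, 5, 7, 10], [1, 2, 8, 11], [2, 5, 7, 8], [1, 4, 6, 11], [3, 4, 6, 9],
    [1, 2, 5, 10], [2, 7, 9, 10], [0, 3, 4, 11], [0, 4, 7, 9], [3, 6, 8, 11], [1, 5, 6, 8],
    [3, 4, 7, 10], [1, 4, 9, 10], [2, 5, 6, 11], [1, 2, 6, 9], [0, 5, 8, 11], [0, 3, 7, 8],
    [5, 6, 9, 10], [1, 3, 6, 10], [4, 7, 8, 11], [1, 3, 4, 8], [0, 2, 7, 11], [0, 2, 5, 9],
    [1, 7, 8, 10], [3, 5, 8, 10], [0, 6, 9, 11], [0, 3, 5, 6], [2, 4, 9, 11], [1, 2, 4, 7]]"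

lemma H_design_td6: "H_design half (dbl {0..<6}) (set ` set td6)"
  unfolding dbl_atLeastLessThan by (rule H_design_if_lists) code_simp

lemma ex_H_design_dbl:
  assumes "card b = 6"
  shows "\<exists>H. H_design half (dbl b) H"
proof -
  have "finite b" using assms card.infinite by force
  then obtain f where f: "bij_betw f {0..<6::nat} b" using ex_bij_betw_nat_finite assms by metis
  have "H_design half (dbl b) ((`) (map_half f) ` set ` set td6)"
    by (rule H_design_image[OF H_design_td6 bij_betw_map_half[OF f]])
      (use bij_betw_imp_inj_on[OF f] in \<open>auto simp: half_map_half inj_on_eq_iff\<close>)
  then show ?thesis by blast
qed

lemma ex_is_S3_46_dbl:
  assumes "card c = 3 \<or> card c = 5"
  shows "\<exists>G. is_S3_46 (dbl c) G"
  using assms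
proof
  assume "card c = 3"
  then have "finite c" using card.infinite by force
  then have "card (dbl c) = 6" using \<open>card c = 3\<close> by (simp add: card_dbl)
  then show ?thesis using is_S3_46_singleton by blast
next
  assume "card c = 5"
  then have "finite c" using card.infinite by force
  then obtain f where "bij_betw f {0..<5::nat} c" using ex_bij_betw_nat_finite \<open>card c = 5\<close> by metis
  then have f: "bij_betw (map_half f) {0..<10} (dbl c)"
    using bij_betw_map_half dbl_atLeastLessThan[of 5] by force
  have "is_S3_46 (dbl c) ((`) (map_half f) ` set ` set sqs10)"
    unfolding is_S3_46_iff_H_design
    by (rule H_design_image[OF is_S3_46_sqs10[unfolded is_S3_46_iff_H_design] f])
      (use bij_betw_imp_inj_on[OF f] in \<open>auto simp: inj_on_eq_iff\<close>)
  then show ?thesis by blast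
qed

definition even_transversals :: "nat set \<Rightarrow> nat set set" where
  "even_transversals b = {h. h \<subseteq> dbl b \<and> card h = 4 \<and> inj_on half h \<and> even (\<Sum>h)}"

lemma transversal_extension_iff:
  assumes T: "inj_on half T" "finite T" and b: "half ` T \<union> {y} = b" "y \<notin> half ` T"
  shows "h \<subseteq> dbl b \<and> card h = Suc (card T) \<and> inj_on half h \<and> T \<subseteq> h \<longleftrightarrow>
    (\<exists>q. half q = y \<and> h = insert q T)"
proof
  assume h: "h \<subseteq> dbl b \<and> card h = Suc (card T) \<and> inj_on half h \<and> T \<subseteq> h"
  then have "card (h - T) = 1" using T(2) by (simp add: card_Diff_subset)
  then obtain q where q: "h - T = {q}" by (rule card_1_singletonE)
  then have "half q \<notin> half ` T" using h by (auto dest: inj_onD)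
  moreover have "half q \<in> b" using h q by auto
  ultimately show "\<exists>q. half q = y \<and> h = insert q T" using b h q by blast
next
  assume "\<exists>q. half q = y \<and> h = insert q T"
  then obtain q where q: "half q = y" "h = insert q T" by blast
  then have "q \<notin> T" using b(2) by blast
  then show "h \<subseteq> dbl b \<and> card h = Suc (card T) \<and> inj_on half h \<and> T \<subseteq> h"
    using q b T by auto
qed

lemma H_design_even_transversals:
  assumes b: "card b = 4"
  shows "H_design half (dbl b) (even_transversals b)"
proof (rule H_designI)
  fix T assume T: "T \<subseteq> dbl b" "card T = 3" "inj_on half T"
  have "finite b" "finite T" using b T(2) card.infinite by force+
  have "half ` T \<subseteq> b" using T(1) by blast
  moreover have "card (half ` T) = 3" using T by (simp add: card_image)
  ultimately have "card (b - half ` T) = 1" using b \<open>finite T\<close> by (simp add: card_Diff_subset)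
  then obtain y where "b - half ` T = {y}" by (rule card_1_singletonE)
  then have y: "half ` T \<union> {y} = b" "y \<notin> half ` T" using \<open>half ` T \<subseteq> b\<close> by blast+
  define q where "q = 2 * y + (\<Sum>T) mod 2"
  then have "half q = y" by simp
  have parity: "even (\<Sum>(insert p T)) \<longleftrightarrow> p = q" if "half p = y" for p
  proof -
    have "p \<notin> T" using that y(2) by blast
    then have "even (\<Sum>(insert p T)) \<longleftrightarrow> p mod 2 = (\<Sum>T) mod 2"
      using \<open>finite T\<close> by simp presburger
    also have "\<dots> \<longleftrightarrow> p = q" unfolding q_def that[symmetric] by presburger
    finally show ?thesis .
  qed
  have "h \<in> even_transversals b \<and> T \<subseteq> h \<longleftrightarrow> h = insert q T" for h
  proof -
    have "h \<in> even_transversals b \<and> T \<subseteq> h \<longleftrightarrow> (\<exists>p. half p = y \<and> h = insert p T) \<and> even (\<Sum>h)"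
      using transversal_extension_iff[OF T(3) \<open>finite T\<close> y, of h] T(2)
      by (auto simp: even_transversals_def)
    also have "\<dots> \<longleftrightarrow> h = insert q T" using parity \<open>half q = y\<close> by metis
    finally show ?thesis .
  qed
  then show "\<exists>!h. h \<in> even_transversals b \<and> T \<subseteq> h" by simp
qed (simp_all add: even_transversals_def)

subsection \<open>Two recursive constructions\<close>

definition fibre_design :: "nat set \<Rightarrow> nat set set" where
  "fibre_design b =
     (if card b = 2 then {dbl b}
      else if card b = 4 then even_transversals b
      else if card b = 6 then SOME H. H_design half (dbl b) H
      else SOME G. is_S3_46 (dbl b) G)"

lemma H_design_fibre_design:
  assumes "card b = 4 \<or> card b = 6"
  shows "H_design half (dbl b) (fibre_design b)"
  using assms H_design_even_transversals someI_ex[OF ex_H_design_dbl]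
  by (auto simp: fibre_design_def)

lemma is_S3_46_fibre_design:
  assumes "card c = 2 \<or> card c = 3 \<or> card c = 5"
  shows "is_S3_46 (dbl c) (fibre_design c)"
proof (cases "card c = 2")
  case True
  then have "finite c" using card.infinite by force
  then have "card (dbl c) = 4" using True by (simp add: card_dbl)
  then show ?thesis using True by (simp add: fibre_design_def is_S3_46_singleton)
next
  case False
  then show ?thesis using assms someI_ex[OF ex_is_S3_46_dbl] by (auto simp: fibre_design_def)
qed

definition inflate :: "nat set set \<Rightarrow> nat set set" where
  "inflate B = \<Union>(fibre_design ` B)"

lemma card_half_vimage: "card (half -` {y}) = 2"
  using card_dbl[of "{y}"] by simp

lemma is_S3_46_inflate:
  assumes "\<Union>(B \<union> C) \<subseteq> X"
    and "\<And>b. b \<in> B \<Longrightarrow> card b = 4 \<or> card b = 6"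
    and "\<And>c. c \<in> C \<Longrightarrow> card c = 2 \<or> card c = 3 \<or> card c = 5"
    and "\<And>P. P \<subseteq> X \<Longrightarrow> card P = 2 \<Longrightarrow> \<exists>!c. c \<in> C \<and> P \<subseteq> c"
    and "\<And>T. T \<subseteq> X \<Longrightarrow> card T = 3 \<Longrightarrow> \<exists>!b. b \<in> B \<union> C \<and> T \<subseteq> b"
  shows "is_S3_46 (dbl X) (inflate (B \<union> C))"
  unfolding inflate_def using assms
  by (intro is_S3_46_vimage card_half_vimage H_design_fibre_design is_S3_46_fibre_design)

abbreviation pairs :: "'a set \<Rightarrow> 'a set set" where
  "pairs X \<equiv> {P. P \<subseteq> X \<and> card P = 2}"

lemma is_S3_46_double:
  assumes S: "is_S3_46 X B"
  shows "is_S3_46 (dbl X) (inflate (B \<union> pairs X))"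
proof (rule is_S3_46_inflate)
  show "\<Union>(B \<union> pairs X) \<subseteq> X" using is_S3_46_block_subset[OF S] by blast
next
  fix P assume P: "P \<subseteq> X" "card P = 2"
  have "c = P" if "card c = 2" "P \<subseteq> c" for c
    using that P(2) card_subset_eq[of c P] card.infinite[of c] by force
  then have "c \<in> pairs X \<and> P \<subseteq> c \<longleftrightarrow> c = P" for c using P by auto
  then show "\<exists>!c. c \<in> pairs X \<and> P \<subseteq> c" by simp
next
  fix T assume T: "T \<subseteq> X" "card T = 3"
  have "\<not> T \<subseteq> c" if "card c = 2" for c
    using that T(2) card_mono[of c T] card.infinite[of c] by force
  then have "b \<in> B \<union> pairs X \<and> T \<subseteq> b \<longleftrightarrow> b \<in> B \<and> T \<subseteq> b" for b by auto
  then show "\<exists>!b. b \<in> B \<union> pairs X \<and> T \<subseteq> b" using is_S3_46_ex1[OF S T] by simp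
qed (use is_S3_46_block_card[OF S] in auto)

definition derived :: "'a \<Rightarrow> 'a set set \<Rightarrow> 'a set set" where
  "derived u B = (\<lambda>b. b - {u}) ` {b \<in> B. u \<in> b}"

definition residual :: "'a \<Rightarrow> 'a set set \<Rightarrow> 'a set set" where
  "residual u B = {b \<in> B. u \<notin> b}"

lemma residual_Un_derived: "residual u B \<union> derived u B = (\<lambda>b. b - {u}) ` B"
proof -
  have "residual u B = (\<lambda>b. b - {u}) ` residual u B"
    by (simp add: residual_def cong: image_cong_simp)
  then have "residual u B \<union> derived u B = (\<lambda>b. b - {u}) ` (residual u B \<union> {b \<in> B. u \<in> b})"
    by (simp add: derived_def image_Un)
  also have "residual u B \<union> {b \<in> B. u \<in> b} = B" by (auto simp: residual_def)
  finally show ?thesis .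
qed

lemma ex1_residual_Un_derived_superset:
  assumes S: "is_S3_46 (insert u X) B" and u: "u \<notin> X" and T: "T \<subseteq> X" "card T = 3"
  shows "\<exists>!b. b \<in> residual u B \<union> derived u B \<and> T \<subseteq> b"
proof -
  have "\<exists>!b. b \<in> B \<and> T \<subseteq> b" by (rule is_S3_46_ex1[OF S]) (use T in auto)
  then show ?thesis
    unfolding residual_Un_derived by (rule ex1_image) (use u T(1) in blast)
qed

lemma ex1_derived_superset:
  assumes S: "is_S3_46 (insert u X) B" and u: "u \<notin> X" and P: "P \<subseteq> X" "card P = 2"
  shows "\<exists>!c. c \<in> derived u B \<and> P \<subseteq> c"
proof -
  have "finite P" using P(2) card.infinite by force
  moreover have "u \<notin> P" using u P(1) by blast
  ultimately have "card (insert u P) = 3" using P(2) by simp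
  then have "\<exists>!b. b \<in> B \<and> insert u P \<subseteq> b" using P(1) by (intro is_S3_46_ex1[OF S]) blast
  then have "\<exists>!b. b \<in> {b \<in> B. u \<in> b} \<and> P \<subseteq> b" by (simp add: conj_assoc)
  then show ?thesis
    unfolding derived_def by (rule ex1_image) (use \<open>u \<notin> P\<close> in blast)
qed

lemma is_S3_46_double_minus_point:
  assumes S: "is_S3_46 (insert u X) B" and u: "u \<notin> X"
  shows "is_S3_46 (dbl X) (inflate (residual u B \<union> derived u B))"
proof (rule is_S3_46_inflate)
  show "\<Union>(residual u B \<union> derived u B) \<subseteq> X"
    unfolding residual_Un_derived using is_S3_46_block_subset[OF S] by blast
  show "card b = 4 \<or> card b = 6" if "b \<in> residual u B" for b
    using that is_S3_46_block_card[OF S] by (simp add: residual_def)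
  show "card c = 2 \<or> card c = 3 \<or> card c = 5" if c: "c \<in> derived u B" for c
  proof -
    obtain b where "b \<in> B" "u \<in> b" "c = b - {u}" using c unfolding derived_def by blast
    then show ?thesis using is_S3_46_block_card[OF S, of b] by auto
  qed
qed (use ex1_residual_Un_derived_superset[OF S u] ex1_derived_superset[OF S u] in simp_all)

subsection \<open>Designs containing the planes of a Boolean quadruple system\<close>

definition quad :: "nat \<Rightarrow> nat \<times> nat \<times> nat \<Rightarrow> nat set" where
  "quad d = (\<lambda>(p, q, r). {p, q, r, xor d (xor p (xor q r))})"

definition grid :: "nat \<Rightarrow> (nat \<times> nat \<times> nat) set" where
  "grid e = {0..<2 ^ e} \<times> {2 ^ e..<2 * 2 ^ e} \<times> {2 * 2 ^ e..<3 * 2 ^ e}"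

definition xor_quads :: "nat \<Rightarrow> nat set set" where
  "xor_quads e = quad 0 ` grid e"

lemma xor_div_pow2:
  fixes p q :: "'a::semiring_bit_operations"
  shows "xor p q div 2 ^ e = xor (p div 2 ^ e) (q div 2 ^ e)"
  by (metis drop_bit_eq_div drop_bit_xor)

lemma div_eq_iff_atLeastLessThan:
  fixes n k x :: nat
  assumes "0 < n"
  shows "x div n = k \<longleftrightarrow> x \<in> {k * n..<Suc k * n}"
  using assms split_div'[of "\<lambda>q. q = k" x n] by (auto simp: algebra_simps)

lemma mem_grid_iff:
  "(p, q, r) \<in> grid e \<longleftrightarrow> p div 2 ^ e = 0 \<and> q div 2 ^ e = 1 \<and> r div 2 ^ e = 2"
  by (auto simp: grid_def div_eq_iff_atLeastLessThan)

lemma quad_div_pow2: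
  assumes "(p, q, r) \<in> grid e" "d < 2 ^ e"
  shows "xor d (xor p (xor q r)) div 2 ^ e = 3"
  using assms by (simp add: mem_grid_iff xor_div_pow2)

lemma card_quad:
  assumes "t \<in> grid e" "d < 2 ^ e"
  shows "card (quad d t) = 4"
proof -
  obtain p q r where t: "t = (p, q, r)" by (cases t)
  define s where "s = xor d (xor p (xor q r))"
  have "distinct (map (\<lambda>x. x div 2 ^ e) [p, q, r, s])"
    using assms quad_div_pow2 unfolding s_def t by (simp add: mem_grid_iff)
  then have "distinct [p, q, r, s]" unfolding distinct_map by (rule conjunct1)
  from distinct_card[OF this] show ?thesis by (simp add: t quad_def flip: s_def)
qed

lemma quad_subset:
  assumes "t \<in> grid e" "d < 2 ^ e"
  shows "quad d t \<subseteq> {0..<4 * 2 ^ e}"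
proof
  fix x assume "x \<in> quad d t"
  then have "x div 2 ^ e < 4"
    using assms quad_div_pow2 by (cases t) (auto simp: quad_def mem_grid_iff)
  then show "x \<in> {0..<4 * 2 ^ e}" by (simp add: div_less_iff_less_mult)
qed

lemma quad_Suc_in_even_transversals:
  assumes "t \<in> grid (Suc e)"
  shows "\<exists>t'\<in>grid e. quad 0 t \<in> even_transversals (quad 0 t')"
proof -
  obtain p q r where t: "t = (p, q, r)" by (cases t)
  define s where "s = xor p (xor q r)"
  have quad: "quad 0 t = {p, q, r, s}" by (simp add: t quad_def s_def)
  have half: "half s = xor (half p) (xor (half q) (half r))"
    using xor_div_pow2[where 'a = nat, of _ _ 1] by (simp add: s_def)
  have grid: "(half p, half q, half r) \<in> grid e"
    using assms by (simp add: t mem_grid_iff div_mult2_eq)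
  moreover have "quad 0 (half p, half q, half r) = half ` quad 0 t"
    by (simp add: quad half) (simp add: quad_def)
  moreover have card: "card (quad 0 t) = 4" using card_quad[OF assms] by simp
  moreover have "inj_on half (quad 0 t)"
    using card_quad[OF grid, of 0] card calculation(2)
    by (intro eq_card_imp_inj_on) (simp_all add: quad)
  moreover have "even (\<Sum>(quad 0 t))"
  proof -
    have "\<Sum>(quad 0 t) = p + q + r + s"
      using card unfolding quad by (auto simp: card_insert_if split: if_splits)
    then show ?thesis by (auto simp: s_def even_xor_iff)
  qed
  ultimately show ?thesis
    by (intro bexI[of _ "(half p, half q, half r)"]) (auto simp: even_transversals_def)
qed

text \<open>
  The points \<open>4 * 2 ^ e, \<dots>, v - 1\<close> are in none of the quadruples, so deleting the last point leaves
  these intact.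
\<close>

definition quads_embeddable :: "nat \<Rightarrow> nat \<Rightarrow> bool" where
  "quads_embeddable e v \<longleftrightarrow> 4 * 2 ^ e < v \<and> v \<le> 12 * 2 ^ e \<and>
     (\<exists>B. is_S3_46 {0..<v} B \<and> xor_quads e \<subseteq> B)"

lemma xor_quads_Suc_subset_inflate:
  assumes "xor_quads e \<subseteq> B"
  shows "xor_quads (Suc e) \<subseteq> inflate B"
proof
  fix h assume "h \<in> xor_quads (Suc e)"
  then obtain t where t: "t \<in> grid e" "h \<in> even_transversals (quad 0 t)"
    using quad_Suc_in_even_transversals unfolding xor_quads_def by blast
  then have "h \<in> fibre_design (quad 0 t)" using card_quad[of t e 0] by (simp add: fibre_design_def)
  moreover have "quad 0 t \<in> B" using t(1) assms by (auto simp: xor_quads_def)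
  ultimately show "h \<in> inflate B" unfolding inflate_def by blast
qed

lemma quads_embeddable_double:
  assumes "quads_embeddable e u"
  shows "quads_embeddable (Suc e) (2 * u)"
proof -
  obtain B where B: "is_S3_46 {0..<u} B" "xor_quads e \<subseteq> B"
    using assms by (auto simp: quads_embeddable_def)
  from B(2) have "xor_quads e \<subseteq> B \<union> pairs {0..<u}" by blast
  from xor_quads_Suc_subset_inflate[OF this] is_S3_46_double[OF B(1)]
  have "\<exists>D. is_S3_46 {0..<2 * u} D \<and> xor_quads (Suc e) \<subseteq> D"
    unfolding dbl_atLeastLessThan by blast
  then show ?thesis using assms by (simp add: quads_embeddable_def)
qed

lemma quads_embeddable_double_minus_point:
  assumes "quads_embeddable e (Suc u)" "odd u"
  shows "quads_embeddable (Suc e) (2 * u)"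
proof -
  obtain B where B: "is_S3_46 {0..<Suc u} B" "xor_quads e \<subseteq> B"
    using assms by (auto simp: quads_embeddable_def)
  have "4 * 2 ^ e \<le> u" using assms(1) by (simp add: quads_embeddable_def)
  moreover have "u \<noteq> 4 * 2 ^ e" using assms(2) by auto
  ultimately have "4 * 2 ^ e < u" by simp
  then have "u \<notin> quad 0 t" if "t \<in> grid e" for t using quad_subset[OF that, of 0] by auto
  then have "xor_quads e \<subseteq> residual u B \<union> derived u B"
    using B(2) by (auto simp: residual_def xor_quads_def)
  from xor_quads_Suc_subset_inflate[OF this]
  have "xor_quads (Suc e) \<subseteq> inflate (residual u B \<union> derived u B)" .
  moreover have "is_S3_46 (dbl {0..<u}) (inflate (residual u B \<union> derived u B))"
    using B(1) by (intro is_S3_46_double_minus_point) (simp_all add: atLeast0_lessThan_Suc)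
  ultimately have "\<exists>D. is_S3_46 {0..<2 * u} D \<and> xor_quads (Suc e) \<subseteq> D"
    unfolding dbl_atLeastLessThan by blast
  then show ?thesis using assms(1) \<open>4 * 2 ^ e < u\<close> by (simp add: quads_embeddable_def)
qed

lemma quads_embeddable_0:
  assumes "is_S3_46 {0..<v} B" "{0, 1, 2, 3} \<in> B" "4 < v" "v \<le> 12"
  shows "quads_embeddable 0 v"
proof -
  have "grid 0 = {(0, 1, 2)}" by (auto simp: grid_def)
  then have "xor_quads 0 = {{0, 1, 2, 3}}" by (simp add: xor_quads_def quad_def)
  then show ?thesis using assms by (auto simp: quads_embeddable_def)
qed

lemma quads_embeddable_0_double:
  assumes "u = 4 \<or> u = 6"
  shows "quads_embeddable 0 (2 * u)"
proof (rule quads_embeddable_0)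
  let ?B = "{{0..<u}} \<union> pairs {0..<u}"
  have "is_S3_46 {0..<u} {{0..<u}}" using assms by (intro is_S3_46_singleton) auto
  from is_S3_46_double[OF this] show "is_S3_46 {0..<2 * u} (inflate ?B)"
    unfolding dbl_atLeastLessThan .
  have "{0, 1} \<in> ?B" using assms by auto
  moreover have "dbl {0, 1} = {0, 1, 2, 3}" by (auto; presburger)
  then have "{0, 1, 2, 3} \<in> fibre_design {0, 1}" by (simp add: fibre_design_def)
  ultimately show "{0, 1, 2, 3} \<in> inflate ?B" unfolding inflate_def by blast
qed (use assms in auto)

lemma quads_embeddable_0_10: "quads_embeddable 0 10"
proof (rule quads_embeddable_0[OF is_S3_46_sqs10])
  have "set [0, 1, 2, 3] \<in> set ` set sqs10" by (rule imageI) (simp add: sqs10_def)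
  then show "{0, 1, 2, 3} \<in> set ` set sqs10" by simp
qed simp_all

lemma ex_quads_embeddable:
  assumes "even v" "8 \<le> v"
  shows "\<exists>e. quads_embeddable e v"
  using assms
proof (induction v rule: less_induct)
  case (less v)
  obtain u where v: "v = 2 * u" using less.prems(1) by blast
  have "u = 4 \<or> u = 6 \<or> u = 5 \<or> even u \<and> 8 \<le> u \<or> odd u \<and> 7 \<le> u"
    using less.prems(2) unfolding v by presburger
  then consider "u = 4 \<or> u = 6" | "u = 5" | "even u" "8 \<le> u" | "odd u" "7 \<le> u" by blast
  then show ?case
  proof cases
    case 1
    then show ?thesis using quads_embeddable_0_double v by blast
  next
    case 2
    then show ?thesis using quads_embeddable_0_10 v by auto
  next
    case 3
    then obtain e where "quads_embeddable e u" using less.IH[of u] v by auto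
    then show ?thesis using quads_embeddable_double v by blast
  next
    case 4
    then obtain e where "quads_embeddable e (Suc u)" using less.IH[of "Suc u"] v by auto
    then show ?thesis using quads_embeddable_double_minus_point 4(1) v by blast
  qed
qed

subsection \<open>Counting sets of pairwise compatible elements\<close>

definition pairwise_subsets :: "('a \<Rightarrow> 'a \<Rightarrow> bool) \<Rightarrow> 'a set \<Rightarrow> nat \<Rightarrow> 'a set set" where
  "pairwise_subsets R V j = {F. F \<subseteq> V \<and> card F = j \<and> pairwise R F}"

definition compatible :: "('a \<Rightarrow> 'a \<Rightarrow> bool) \<Rightarrow> 'a set \<Rightarrow> 'a set \<Rightarrow> 'a set" where
  "compatible R V F = {w \<in> V. w \<notin> F \<and> (\<forall>v\<in>F. R v w)}"

lemma finite_pairwise_subsets: "finite V \<Longrightarrow> finite (pairwise_subsets R V j)"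
  by (rule finite_subset[of _ "Pow V"]) (auto simp: pairwise_subsets_def)

lemma finite_in_pairwise_subsets:
  "finite V \<Longrightarrow> F \<in> pairwise_subsets R V j \<Longrightarrow> finite F"
  by (auto simp: pairwise_subsets_def intro: finite_subset)

lemma card_compatible_ge:
  assumes V: "finite V" and F: "finite F" "F \<subseteq> V"
    and k: "\<And>v. v \<in> V \<Longrightarrow> card {w \<in> V. w = v \<or> \<not> R v w} \<le> k"
  shows "card V - k * card F \<le> card (compatible R V F)"
proof -
  let ?U = "\<Union>v\<in>F. {w \<in> V. w = v \<or> \<not> R v w}"
  have "card ?U \<le> (\<Sum>v\<in>F. card {w \<in> V. w = v \<or> \<not> R v w})" by (rule card_UN_le[OF F(1)])
  also have "\<dots> \<le> (\<Sum>v\<in>F. k)" by (rule sum_mono) (use k F(2) in blast)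
  finally have "card V - k * card F \<le> card V - card ?U" by (simp add: mult.commute)
  also have "\<dots> \<le> card (V - ?U)"
    by (rule diff_card_le_card_Diff) (use F(1) V in simp)
  also have "V - ?U = compatible R V F" by (auto simp: compatible_def)
  finally show ?thesis .
qed

lemma insert_in_pairwise_subsets:
  assumes V: "finite V" and R: "symp R"
    and F: "F \<in> pairwise_subsets R V j" "w \<in> compatible R V F"
  shows "insert w F \<in> pairwise_subsets R V (Suc j)"
proof -
  have "pairwise R (insert w F)"
    using F R unfolding pairwise_insert
    by (auto simp: compatible_def pairwise_subsets_def dest: sympD)
  then show ?thesis
    using F finite_in_pairwise_subsets[OF V F(1)]
    by (auto simp: compatible_def pairwise_subsets_def)
qed

lemma card_pairwise_subsets_Suc:
  assumes V: "finite V" and sym: "symp R"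
    and k: "\<And>v. v \<in> V \<Longrightarrow> card {w \<in> V. w = v \<or> \<not> R v w} \<le> k"
  shows "card (pairwise_subsets R V j) * (card V - k * j)
    \<le> card (pairwise_subsets R V (Suc j)) * Suc j"
proof -
  let ?P = "pairwise_subsets R V"
  let ?I = "SIGMA F:?P j. compatible R V F" and ?J = "SIGMA F:?P (Suc j). F"
  note finite_subsets = finite_pairwise_subsets[OF V] finite_in_pairwise_subsets[OF V]
  have finite_compatible: "finite (compatible R V F)" for F using V by (simp add: compatible_def)
  have "card (?P j) * (card V - k * j) = (\<Sum>F\<in>?P j. card V - k * j)" by simp
  also have "\<dots> \<le> (\<Sum>F\<in>?P j. card (compatible R V F))"
  proof (rule sum_mono)
    fix F assume F: "F \<in> ?P j"
    then have "F \<subseteq> V" "card F = j" by (simp_all add: pairwise_subsets_def)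
    then show "card V - k * j \<le> card (compatible R V F)"
      using card_compatible_ge[OF V finite_subsets(2)[OF F] _ k] by simp
  qed
  also have "\<dots> = card ?I"
    by (rule card_SigmaI[symmetric]) (use finite_subsets(1) finite_compatible in auto)
  also have "\<dots> \<le> card ?J"
  proof (rule card_inj_on_le[of "\<lambda>(F, w). (insert w F, w)"])
    have "F = F'"
      if "w \<in> compatible R V F" "w \<in> compatible R V F'" "insert w F = insert w F'" for F F' w
      using that by (simp add: compatible_def insert_ident)
    then show "inj_on (\<lambda>(F, w). (insert w F, w)) ?I" by (auto intro!: inj_onI)
    show "(\<lambda>(F, w). (insert w F, w)) ` ?I \<subseteq> ?J"
      using insert_in_pairwise_subsets[OF V sym] by auto
    show "finite ?J" using finite_subsets by (intro finite_SigmaI)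
  qed
  also have "\<dots> = (\<Sum>F\<in>?P (Suc j). card F)" by (rule card_SigmaI) (use finite_subsets in auto)
  also have "\<dots> = card (?P (Suc j)) * Suc j" by (simp add: pairwise_subsets_def)
  finally show ?thesis .
qed

lemma card_pairwise_subsets_ge:
  assumes V: "finite V" and sym: "symp R"
    and k: "\<And>v. v \<in> V \<Longrightarrow> card {w \<in> V. w = v \<or> \<not> R v w} \<le> k"
    and j: "(q + k) * j \<le> card V"
  shows "q ^ j \<le> card (pairwise_subsets R V j)"
  using j
proof (induction j)
  case 0
  have "{} \<in> pairwise_subsets R V 0" by (simp add: pairwise_subsets_def)
  then have "0 < card (pairwise_subsets R V 0)"
    using finite_pairwise_subsets[OF V] by (auto simp: card_gt_0_iff)
  then show ?case by simp
next
  case (Suc j)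
  have "q * Suc j \<le> card V - k * j" using Suc.prems by (simp add: algebra_simps)
  have "q ^ Suc j * Suc j = q ^ j * (q * Suc j)" by (simp only: power_Suc ac_simps)
  also have "\<dots> \<le> card (pairwise_subsets R V j) * (card V - k * j)"
    by (rule mult_le_mono[OF Suc.IH \<open>q * Suc j \<le> card V - k * j\<close>])
      (use Suc.prems in \<open>simp add: algebra_simps\<close>)
  also have "\<dots> \<le> card (pairwise_subsets R V (Suc j)) * Suc j"
    by (rule card_pairwise_subsets_Suc[OF V sym k])
  finally show ?case by (simp del: mult_Suc_right)
qed

subsection \<open>Trades\<close>

definition trade :: "'a set set \<Rightarrow> 'a set set \<Rightarrow> bool" where
  "trade A A' \<longleftrightarrow> (\<forall>b\<in>A'. card b = 4 \<or> card b = 6) \<and> A \<inter> A' = {} \<and>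
     (\<forall>T. card T = 3 \<longrightarrow> (\<exists>b\<in>A. T \<subseteq> b) = (\<exists>b\<in>A'. T \<subseteq> b)) \<and>
     (\<forall>b\<in>A'. \<forall>b'\<in>A'. \<forall>T. card T = 3 \<and> T \<subseteq> b \<and> T \<subseteq> b' \<longrightarrow> b = b')"

lemma trade_card: "trade A A' \<Longrightarrow> b \<in> A' \<Longrightarrow> card b = 4 \<or> card b = 6"
  unfolding trade_def by (elim conjE) (rule bspec)

lemma trade_disjoint: "trade A A' \<Longrightarrow> A \<inter> A' = {}"
  unfolding trade_def by (elim conjE)

lemma trade_covers_iff:
  "trade A A' \<Longrightarrow> card T = 3 \<Longrightarrow> (\<exists>b\<in>A. T \<subseteq> b) \<longleftrightarrow> (\<exists>b\<in>A'. T \<subseteq> b)"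
  by (simp add: trade_def)

lemma trade_unique:
  "trade A A' \<Longrightarrow> b \<in> A' \<Longrightarrow> b' \<in> A' \<Longrightarrow> card T = 3 \<Longrightarrow> T \<subseteq> b \<Longrightarrow> T \<subseteq> b' \<Longrightarrow> b = b'"
  unfolding trade_def by (elim conjE) blast

lemma trade_ex1:
  assumes "trade A A'" "b \<in> A" "T \<subseteq> b" "card T = 3"
  shows "\<exists>!b'. b' \<in> A' \<and> T \<subseteq> b'"
proof -
  obtain b' where b': "b' \<in> A'" "T \<subseteq> b'" using trade_covers_iff[OF assms(1,4)] assms(2,3) by blast
  have "a = b'" if "a \<in> A' \<and> T \<subseteq> a" for a
    using that b' by (intro trade_unique[OF assms(1) _ b'(1) assms(4)]) simp_all
  then show ?thesis using b' by blast
qed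

lemma trade_block_subset:
  assumes "trade A A'" "b \<in> A'"
  shows "b \<subseteq> \<Union>A"
proof
  fix x assume x: "x \<in> b"
  have "card b = 4 \<or> card b = 6" by (rule trade_card[OF assms])
  then have "2 \<le> card (b - {x})" using x by auto
  then obtain P where P: "P \<subseteq> b - {x}" "card P = 2" "finite P" by (rule obtain_subset_with_card_n)
  then have "card (insert x P) = 3" by (subst card_insert_disjoint) auto
  moreover have "insert x P \<subseteq> b" using P(1) x by blast
  ultimately have "\<exists>a\<in>A. insert x P \<subseteq> a" using trade_covers_iff[OF assms(1)] assms(2) by blast
  then show "x \<in> \<Union>A" by blast
qed

lemma trade_disjoint_design:
  assumes S: "is_S3_46 X B" and A: "trade A A'" "A \<subseteq> B"
  shows "A' \<inter> B = {}"
proof (rule ccontr)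
  assume "A' \<inter> B \<noteq> {}"
  then obtain b where b: "b \<in> A'" "b \<in> B" by blast
  have "3 \<le> card b" using trade_card[OF A(1) b(1)] by auto
  then obtain T where T: "T \<subseteq> b" "card T = 3" by (rule obtain_subset_with_card_n)
  then obtain a where a: "a \<in> A" "T \<subseteq> a" using trade_covers_iff[OF A(1) T(2)] b(1) by blast
  then have "a = b" using A(2) b(2) T by (intro is_S3_46_unique[OF S]) auto
  then show False using a(1) b(1) trade_disjoint[OF A(1)] by blast
qed

locale trade_family =
  fixes X :: "'a set" and B :: "'a set set" and I :: "'i set" and A A' :: "'i \<Rightarrow> 'a set set"
  assumes design: "is_S3_46 X B"
    and trades: "\<And>i. i \<in> I \<Longrightarrow> trade (A i) (A' i)"
    and old_subset: "\<And>i. i \<in> I \<Longrightarrow> A i \<subseteq> B"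
begin

definition apply_trades :: "'i set \<Rightarrow> 'a set set" where
  "apply_trades F = B - \<Union>(A ` F) \<union> \<Union>(A' ` F)"

lemma apply_trades_ex1:
  assumes F: "F \<subseteq> I" "pairwise (\<lambda>i j. disjnt (A i) (A j)) F"
    and b: "b \<in> B" "T \<subseteq> b" and T: "card T = 3"
  shows "\<exists>!h. h \<in> apply_trades F \<and> T \<subseteq> h"
proof -
  have unique: "h = b" if "h \<in> B" "T \<subseteq> h" for h
    by (rule is_S3_46_unique[OF design that(1) b(1) that(2) b(2) T])
  have traded: "b \<in> A i" if "i \<in> F" "h \<in> A' i" "T \<subseteq> h" for i h
  proof -
    have "i \<in> I" using F(1) that(1) by blast
    then show ?thesis
      using trade_covers_iff[OF trades T] old_subset[of i] that(2,3) unique by blast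
  qed
  show ?thesis
  proof (cases "\<exists>i\<in>F. b \<in> A i")
    case True
    then obtain i where i: "i \<in> F" "b \<in> A i" by blast
    have only_i: "j = i" if "j \<in> F" "b \<in> A j" for j
      using F(2) i that by (auto simp: pairwise_def disjnt_def)
    have "h \<in> apply_trades F \<and> T \<subseteq> h \<longleftrightarrow> h \<in> A' i \<and> T \<subseteq> h" for h
      using i unique[of h] traded[of _ h] only_i unfolding apply_trades_def by blast
    moreover have "i \<in> I" using F(1) i(1) by blast
    ultimately show ?thesis using trade_ex1[OF trades i(2) b(2) T] by simp
  next
    case False
    have "h = b" if "h \<in> apply_trades F \<and> T \<subseteq> h" for h
      using that False unique[of h] traded[of _ h] unfolding apply_trades_def by blast
    moreover have "b \<in> apply_trades F" using b(1) False by (simp add: apply_trades_def)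
    ultimately show ?thesis using b(2) by blast
  qed
qed

lemma is_S3_46_apply_trades:
  assumes F: "F \<subseteq> I" "pairwise (\<lambda>i j. disjnt (A i) (A j)) F"
  shows "is_S3_46 X (apply_trades F)"
proof (rule is_S3_46I)
  fix b assume "b \<in> apply_trades F"
  then consider "b \<in> B" | i where "i \<in> I" "b \<in> A' i" using F(1) by (auto simp: apply_trades_def)
  then have "b \<subseteq> X \<and> (card b = 4 \<or> card b = 6)"
  proof cases
    case 1
    then show ?thesis using is_S3_46_block_subset[OF design] is_S3_46_block_card[OF design] by blast
  next
    case (2 i)
    have "b \<subseteq> \<Union>B" using trade_block_subset[OF trades 2(2)] old_subset 2(1) by blast
    then have "b \<subseteq> X" using is_S3_46_block_subset[OF design] by blast
    then show ?thesis using trade_card[OF trades 2(2)] 2(1) by blast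
  qed
  then show "b \<subseteq> X" "card b = 4 \<or> card b = 6" by blast+
next
  fix T assume T: "T \<subseteq> X" "card T = 3"
  then obtain b where "b \<in> B" "T \<subseteq> b" using is_S3_46_ex1[OF design T] by blast
  then show "\<exists>!h. h \<in> apply_trades F \<and> T \<subseteq> h" using T(2) by (rule apply_trades_ex1[OF F])
qed

lemma inj_on_apply_trades:
  assumes disj: "pairwise (\<lambda>i j. disjnt (A' i) (A' j)) I"
    and nonempty: "\<And>i. i \<in> I \<Longrightarrow> A' i \<noteq> {}"
  shows "inj_on apply_trades (Pow I)"
proof (rule inj_on_inverseI)
  fix F assume "F \<in> Pow I"
  then have F: "F \<subseteq> I" by blast
  have "A' i \<inter> apply_trades F \<noteq> {} \<longleftrightarrow> i \<in> F" if i: "i \<in> I" for i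
  proof
    assume "A' i \<inter> apply_trades F \<noteq> {}"
    moreover have "A' i \<inter> B = {}"
      by (rule trade_disjoint_design[OF design trades[OF i] old_subset[OF i]])
    ultimately obtain j where "j \<in> F" "A' i \<inter> A' j \<noteq> {}" by (auto simp: apply_trades_def)
    then have "i = j" using disj F i unfolding pairwise_def disjnt_def by blast
    then show "i \<in> F" using \<open>j \<in> F\<close> by simp
  next
    assume "i \<in> F"
    then show "A' i \<inter> apply_trades F \<noteq> {}" using nonempty[OF i] by (auto simp: apply_trades_def)
  qed
  then show "{i \<in> I. A' i \<inter> apply_trades F \<noteq> {}} = F" using F by blast
qed

lemma card_disjoint_trades_le:
  assumes X: "finite X"
    and disj: "pairwise (\<lambda>i j. disjnt (A' i) (A' j)) I"
    and nonempty: "\<And>i. i \<in> I \<Longrightarrow> A' i \<noteq> {}"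
  shows "card (pairwise_subsets (\<lambda>i j. disjnt (A i) (A j)) I k) \<le> card {B. is_S3_46 X B}"
proof (rule card_inj_on_le)
  show "inj_on apply_trades (pairwise_subsets (\<lambda>i j. disjnt (A i) (A j)) I k)"
    by (rule inj_on_subset[OF inj_on_apply_trades[OF disj nonempty]])
      (auto simp: pairwise_subsets_def)
  show "apply_trades ` pairwise_subsets (\<lambda>i j. disjnt (A i) (A j)) I k \<subseteq> {B. is_S3_46 X B}"
    by (auto simp: pairwise_subsets_def is_S3_46_apply_trades)
qed (rule finite_is_S3_46[OF X])

end

subsection \<open>Trades in the Boolean quadruple system\<close>

definition cube :: "nat \<Rightarrow> nat \<times> nat \<times> nat \<Rightarrow> (nat \<times> nat \<times> nat) set" where
  "cube c = (\<lambda>(p, q, r). {p, xor c p} \<times> {q, xor c q} \<times> {r, xor c r})"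

lemma xor_cancel_left:
  fixes c x :: "'a::semiring_bit_operations"
  shows "xor c (xor c x) = x"
  by (simp flip: xor.assoc)

lemma xor_left_inject:
  fixes c x y :: "'a::semiring_bit_operations"
  shows "xor c x = xor c y \<longleftrightarrow> x = y"
  by (metis xor_cancel_left)

lemma xor_right_inject:
  fixes c x y :: "'a::semiring_bit_operations"
  shows "xor x c = xor y c \<longleftrightarrow> x = y"
  by (metis xor.commute xor_cancel_left)

lemma xor_eq_right_iff:
  fixes c x :: "'a::semiring_bit_operations"
  shows "xor c x = x \<longleftrightarrow> c = 0"
  using xor_right_inject[of c x 0] by simp

lemma mem_cube_self: "t \<in> cube c t"
  by (cases t) (simp add: cube_def)

lemma cube_eq:
  assumes "t' \<in> cube c t"
  shows "cube c t' = cube c t"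
proof -
  have pair_eq: "{x', xor c x'} = {x, xor c x}" if "x' \<in> {x, xor c x}" for x x'
    using that by (auto simp: xor_cancel_left)
  obtain p q r p' q' r' where tt': "t = (p, q, r)" "t' = (p', q', r')" by (cases t; cases t')
  have "p' \<in> {p, xor c p}" "q' \<in> {q, xor c q}" "r' \<in> {r, xor c r}"
    using assms unfolding tt' cube_def prod.case by blast+
  from this[THEN pair_eq] show ?thesis by (simp only: tt' cube_def prod.case)
qed

lemma finite_cube: "finite (cube c t)"
  by (cases t) (simp add: cube_def)

lemma card_cube:
  assumes "c \<noteq> 0"
  shows "card (cube c t) = 8"
proof -
  have "card {x, xor c x} = 2" for x using xor_eq_right_iff[of c x] assms by auto
  then show ?thesis by (cases t) (simp only: cube_def prod.case card_cartesian_product)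
qed

lemma finite_grid: "finite (grid e)"
  by (simp add: grid_def)

lemma card_grid: "card (grid e) = (2 ^ e) ^ 3"
  by (simp add: grid_def card_cartesian_product power3_eq_cube)

lemma cube_subset_grid:
  assumes "t \<in> grid e" "c < 2 ^ e"
  shows "cube c t \<subseteq> grid e"
  using assms by (cases t) (auto simp: cube_def mem_grid_iff xor_div_pow2)

lemma card_cubes:
  assumes "0 < c" "c < 2 ^ e"
  shows "8 * card (cube c ` grid e) = (2 ^ e) ^ 3"
proof -
  have union: "\<Union>(cube c ` grid e) = grid e"
    using mem_cube_self cube_subset_grid[OF _ assms(2)] by blast
  have "8 * card (cube c ` grid e) = card (\<Union>(cube c ` grid e))"
  proof (rule card_partition)
    show "C \<inter> C' = {}" if "C \<in> cube c ` grid e" "C' \<in> cube c ` grid e" "C \<noteq> C'" for C C'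
      using that cube_eq by blast
  qed (use assms in \<open>auto simp: union finite_grid card_cube\<close>)
  then show ?thesis by (simp add: union card_grid)
qed

lemma mem_quad_eq:
  assumes "x \<in> quad d (p, q, r)" "(p, q, r) \<in> grid e" "d < 2 ^ e"
  shows "x div 2 ^ e = 0 \<Longrightarrow> x = p" "x div 2 ^ e = 1 \<Longrightarrow> x = q" "x div 2 ^ e = 2 \<Longrightarrow> x = r"
    "x div 2 ^ e = 3 \<Longrightarrow> x = xor d (xor p (xor q r))"
  using assms quad_div_pow2[OF assms(2,3)] by (auto simp: quad_def mem_grid_iff)

lemma quad_eq_iff:
  assumes t: "t \<in> grid e" "t' \<in> grid e" and d: "d < 2 ^ e" "d' < 2 ^ e"
  shows "quad d t = quad d' t' \<longleftrightarrow> d = d' \<and> t = t'"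
proof
  obtain p q r p' q' r' where tt': "t = (p, q, r)" "t' = (p', q', r')" by (cases t; cases t')
  assume eq: "quad d t = quad d' t'"
  have "{p, q, r, xor d (xor p (xor q r))} \<subseteq> quad d' (p', q', r')"
    unfolding tt'(2)[symmetric] eq[symmetric] by (simp add: tt'(1) quad_def)
  then have "p = p'" "q = q'" "r = r'" "xor d (xor p (xor q r)) = xor d' (xor p' (xor q' r'))"
    using t d quad_div_pow2[of p q r e d] mem_quad_eq[of _ d' p' q' r' e]
    unfolding tt' by (simp_all add: mem_grid_iff)
  then show "d = d' \<and> t = t'"
    by (simp add: tt' xor_right_inject)
qed simp

lemma card_3_subset_insert4:
  assumes "T \<subseteq> {p, q, r, s}" "card T = 3"
  shows "T = {q, r, s} \<or> T = {p, r, s} \<or> T = {p, q, s} \<or> T = {p, q, r}"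
proof -
  obtain x y z where "T = {x, y, z}" "x \<noteq> y" "y \<noteq> z" "x \<noteq> z"
    using assms(2) unfolding card_3_iff by blast
  then show ?thesis using assms(1) by auto
qed

lemma quad_unique:
  assumes t: "t \<in> grid e" "t' \<in> grid e" and d: "d < 2 ^ e"
    and T: "T \<subseteq> quad d t" "T \<subseteq> quad d t'" "card T = 3"
  shows "t = t'"
proof -
  obtain p q r p' q' r' where tt': "t = (p, q, r)" "t' = (p', q', r')" by (cases t; cases t')
  define s where "s = xor d (xor p (xor q r))"
  define s' where "s' = xor d (xor p' (xor q' r'))"
  have "s div 2 ^ e = 3" using t(1) d quad_div_pow2 by (simp add: s_def tt')
  then have mem: "p \<in> T \<longrightarrow> p = p'" "q \<in> T \<longrightarrow> q = q'" "r \<in> T \<longrightarrow> r = r'" "s \<in> T \<longrightarrow> s = s'"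
    using t d T(2) mem_quad_eq[of _ d p' q' r' e] unfolding tt' s'_def
    by (auto simp: mem_grid_iff)
  have "T = {q, r, s} \<or> T = {p, r, s} \<or> T = {p, q, s} \<or> T = {p, q, r}"
    by (rule card_3_subset_insert4) (use T in \<open>simp_all add: tt' quad_def s_def\<close>)
  then have "s = s' \<and> (q = q' \<and> r = r' \<or> p = p' \<and> r = r' \<or> p = p' \<and> q = q') \<or>
      p = p' \<and> q = q' \<and> r = r'"
    using mem by auto
  then show ?thesis unfolding tt' s_def s'_def
    by (auto simp: xor_left_inject xor_right_inject)
qed

lemma ex_cube_quad_superset:
  assumes T: "T \<subseteq> quad d t" "card T = 3"
  shows "\<exists>t'\<in>cube c t. T \<subseteq> quad (xor c d) t'"
proof -
  obtain p q r where t: "t = (p, q, r)" by (cases t)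
  define s where "s = xor d (xor p (xor q r))"
  note quad_cube = t s_def quad_def cube_def xor.assoc xor.left_commute[of _ c] xor_cancel_left
  have "T = {q, r, s} \<or> T = {p, r, s} \<or> T = {p, q, s} \<or> T = {p, q, r}"
    by (rule card_3_subset_insert4) (use T in \<open>simp_all add: t quad_def s_def\<close>)
  then show ?thesis
  proof (elim disjE)
    assume "T = {q, r, s}"
    then show ?thesis by (intro bexI[of _ "(xor c p, q, r)"]) (simp_all add: quad_cube)
  next
    assume "T = {p, r, s}"
    then show ?thesis by (intro bexI[of _ "(p, xor c q, r)"]) (simp_all add: quad_cube)
  next
    assume "T = {p, q, s}"
    then show ?thesis by (intro bexI[of _ "(p, q, xor c r)"]) (simp_all add: quad_cube)
  next
    assume "T = {p, q, r}"
    then show ?thesis by (intro bexI[of _ "(p, q, r)"]) (simp_all add: quad_cube)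
  qed
qed

lemma trade_cube:
  assumes t: "t \<in> grid e" and c: "0 < c" "c < 2 ^ e"
  shows "trade (quad 0 ` cube c t) (quad c ` cube c t)"
  unfolding trade_def
proof (intro conjI ballI allI impI)
  have grid: "t' \<in> grid e" if "t' \<in> cube c t" for t' using cube_subset_grid t c(2) that by blast
  show "card b = 4 \<or> card b = 6" if "b \<in> quad c ` cube c t" for b
    using that grid card_quad c(2) by blast
  show "quad 0 ` cube c t \<inter> quad c ` cube c t = {}"
    using grid quad_eq_iff[of _ e _ 0 c] c by auto
  show "(\<exists>b\<in>quad 0 ` cube c t. T \<subseteq> b) \<longleftrightarrow> (\<exists>b\<in>quad c ` cube c t. T \<subseteq> b)"
    if T: "card T = 3" for T
  proof -
    have shift: "\<exists>s'\<in>cube c t. T \<subseteq> quad (xor c d) s'" if "s \<in> cube c t" "T \<subseteq> quad d s" for s d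
      using ex_cube_quad_superset[OF that(2) T, of c] cube_eq[OF that(1)] by simp
    show ?thesis using shift[of _ 0] shift[of _ c] by auto
  qed
  fix b b' T
  assume "b \<in> quad c ` cube c t" "b' \<in> quad c ` cube c t" and T: "card T = 3 \<and> T \<subseteq> b \<and> T \<subseteq> b'"
  then obtain s s' where "s \<in> cube c t" "s' \<in> cube c t" and bb': "b = quad c s" "b' = quad c s'"
    by blast
  then have "s = s'" using quad_unique[OF grid grid c(2), of s s' T] T by simp
  then show "b = b'" by (simp add: bb')
qed

definition cube_trades :: "nat \<Rightarrow> (nat \<times> (nat \<times> nat \<times> nat) set) set" where
  "cube_trades e = (SIGMA c:{1..<2 ^ e}. cube c ` grid e)"

definition old_blocks :: "nat \<times> (nat \<times> nat \<times> nat) set \<Rightarrow> nat set set" where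
  "old_blocks = (\<lambda>(c, C). quad 0 ` C)"

definition new_blocks :: "nat \<times> (nat \<times> nat \<times> nat) set \<Rightarrow> nat set set" where
  "new_blocks = (\<lambda>(c, C). quad c ` C)"

lemma cube_tradesE:
  assumes "i \<in> cube_trades e"
  obtains c t where "i = (c, cube c t)" "0 < c" "c < 2 ^ e" "t \<in> grid e"
  using assms by (auto simp: cube_trades_def)

lemma finite_cube_trades: "finite (cube_trades e)"
  by (simp add: cube_trades_def finite_grid)

lemma card_cube_trades: "8 * card (cube_trades e) = (2 ^ e - 1) * (2 ^ e) ^ 3"
proof -
  have "card (cube_trades e) = (\<Sum>c\<in>{1..<2 ^ e}. card (cube c ` grid e))"
    unfolding cube_trades_def by (rule card_SigmaI) (simp_all add: finite_grid)
  then have "8 * card (cube_trades e) = (\<Sum>c\<in>{1..<2 ^ e}. 8 * card (cube c ` grid e))"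
    by (simp add: sum_distrib_left)
  also have "\<dots> = (\<Sum>c\<in>{1..<2 ^ e :: nat}. (2 ^ e) ^ 3)" by (rule sum.cong) (simp_all add: card_cubes)
  finally show ?thesis by simp
qed

lemma trade_old_new_blocks: "i \<in> cube_trades e \<Longrightarrow> trade (old_blocks i) (new_blocks i)"
  by (erule cube_tradesE) (simp add: old_blocks_def new_blocks_def trade_cube)

lemma old_blocks_subset: "i \<in> cube_trades e \<Longrightarrow> old_blocks i \<subseteq> xor_quads e"
  by (erule cube_tradesE) (simp add: old_blocks_def xor_quads_def image_mono cube_subset_grid)

lemma new_blocks_nonempty: "i \<in> cube_trades e \<Longrightarrow> new_blocks i \<noteq> {}"
  by (erule cube_tradesE) (use mem_cube_self in \<open>force simp: new_blocks_def\<close>)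

lemma pairwise_disjnt_new_blocks:
  "pairwise (\<lambda>i j. disjnt (new_blocks i) (new_blocks j)) (cube_trades e)"
proof (rule pairwiseI)
  fix i j assume i: "i \<in> cube_trades e" and j: "j \<in> cube_trades e" and "i \<noteq> j"
  obtain c t where i': "i = (c, cube c t)" "c < 2 ^ e" "t \<in> grid e" using i by (rule cube_tradesE)
  obtain c' t' where j': "j = (c', cube c' t')" "c' < 2 ^ e" "t' \<in> grid e"
    using j by (rule cube_tradesE)
  have False if s: "s \<in> cube c t" "s' \<in> cube c' t'" "quad c s = quad c' s'" for s s'
  proof -
    have "s \<in> grid e" "s' \<in> grid e" using s(1,2) cube_subset_grid i' j' by blast+
    then have "c = c'" "s = s'" using s(3) quad_eq_iff i'(2) j'(2) by blast+
    then have "cube c t = cube c' t'" using s(1,2) cube_eq by metis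
    then show False using \<open>i \<noteq> j\<close> \<open>c = c'\<close> i'(1) j'(1) by simp
  qed
  then show "disjnt (new_blocks i) (new_blocks j)"
    by (auto simp: i'(1) j'(1) new_blocks_def disjnt_iff)
qed

lemma card_conflicting_cube_trades:
  assumes "i \<in> cube_trades e"
  shows "card {j \<in> cube_trades e. j = i \<or> \<not> disjnt (old_blocks i) (old_blocks j)} \<le> 8 * (2 ^ e - 1)"
    (is "card ?conflicts \<le> _")
proof -
  obtain c t where i: "i = (c, cube c t)" "0 < c" "c < 2 ^ e" "t \<in> grid e"
    using assms by (rule cube_tradesE)
  let ?J = "(\<lambda>(c', s). (c', cube c' s)) ` ({1..<2 ^ e} \<times> cube c t)"
  have "j \<in> ?J" if conflict: "j \<in> ?conflicts" for j
  proof -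
    obtain c' t' where j: "j = (c', cube c' t')" "0 < c'" "c' < 2 ^ e" "t' \<in> grid e"
      using conflict by (blast elim: cube_tradesE)
    have "\<exists>s. s \<in> cube c t \<and> s \<in> cube c' t'"
    proof (cases "j = i")
      case True
      then show ?thesis using i(1) j(1) mem_cube_self by blast
    next
      case False
      then have "\<not> disjnt (old_blocks i) (old_blocks j)" using conflict by blast
      then obtain s s' where s: "s \<in> cube c t" "s' \<in> cube c' t'" "quad 0 s = quad 0 s'"
        unfolding i(1) j(1) old_blocks_def prod.case disjnt_iff by blast
      then have "s \<in> grid e" "s' \<in> grid e" using cube_subset_grid i j by blast+
      then have "s = s'" using s(3) quad_eq_iff[of s e s' 0 0] by simp
      then show ?thesis using s by blast
    qed
    then obtain s where s: "s \<in> cube c t" "s \<in> cube c' t'" by blast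
    then have "j = (c', cube c' s)" using j(1) cube_eq by simp
    then show "j \<in> ?J" using j(2,3) s(1) by auto
  qed
  then have "?conflicts \<subseteq> ?J" by blast
  then have "card ?conflicts \<le> card ?J" by (rule card_mono[rotated]) (simp add: finite_cube)
  also have "\<dots> \<le> card ({1..<2 ^ e :: nat} \<times> cube c t)"
    by (rule card_image_le) (simp add: finite_cube)
  also have "\<dots> = 8 * (2 ^ e - 1)" using i(2) by (simp add: card_cartesian_product card_cube)
  finally show ?thesis .
qed

subsection \<open>The lower bound\<close>

lemma num_S3_46_ge:
  assumes v: "quads_embeddable e v" and j: "128 * j \<le> (2 ^ e) ^ 3"
  shows "(8 * (2 ^ e - 1)) ^ j \<le> num_S3_46 v"
proof -
  obtain B where B: "is_S3_46 {0..<v} B" "xor_quads e \<subseteq> B"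
    using v by (auto simp: quads_embeddable_def)
  have "8 * ((8 * (2 ^ e - 1) + 8 * (2 ^ e - 1)) * j) = (2 ^ e - 1) * (128 * j)" by simp
  also have "\<dots> \<le> 8 * card (cube_trades e)"
    unfolding card_cube_trades using j by (rule mult_left_mono) simp
  finally have "(8 * (2 ^ e - 1) + 8 * (2 ^ e - 1)) * j \<le> card (cube_trades e)"
    by (simp add: ac_simps)
  moreover have "symp (\<lambda>i j. disjnt (old_blocks i) (old_blocks j))"
    by (auto simp: symp_def disjnt_sym)
  ultimately have "(8 * (2 ^ e - 1)) ^ j \<le>
      card (pairwise_subsets (\<lambda>i j. disjnt (old_blocks i) (old_blocks j)) (cube_trades e) j)"
    using card_conflicting_cube_trades by (intro card_pairwise_subsets_ge[OF finite_cube_trades])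
  also have "\<dots> \<le> num_S3_46 v"
  proof -
    interpret trade_family "{0..<v}" B "cube_trades e" old_blocks new_blocks
      using B(1) trade_old_new_blocks subset_trans[OF old_blocks_subset B(2)] by unfold_locales
    show ?thesis
      unfolding num_S3_46_def using pairwise_disjnt_new_blocks new_blocks_nonempty
      by (intro card_disjoint_trades_le) simp_all
  qed
  finally show ?thesis .
qed

lemma cube_div_le_cube_div_128:
  assumes "n \<le> 6 * m" "7 \<le> m"
  shows "real n ^ 3 / 55296 \<le> real (m ^ 3 div 128)"
proof -
  have "343 \<le> m ^ 3" using power_mono[OF assms(2), of 3] by simp
  moreover have "m ^ 3 < 128 + m ^ 3 div 128 * 128" by (rule dividend_less_div_times) simp
  ultimately have "m ^ 3 \<le> 256 * (m ^ 3 div 128)" by linarith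
  moreover have "n ^ 3 \<le> (6 * m) ^ 3" using assms(1) by (rule power_mono) simp
  ultimately have "n ^ 3 \<le> 55296 * (m ^ 3 div 128)" by (simp add: power_mult_distrib)
  then have "real (n ^ 3) \<le> real (55296 * (m ^ 3 div 128))" by (simp only: of_nat_le_iff)
  then show ?thesis by simp
qed

lemma ln_le_double_ln:
  assumes "n \<le> 6 * m" "36 \<le> n"
  shows "ln (real n) \<le> 2 * ln (real m)"
proof -
  have "n * 36 \<le> n * n" using assms(2) by (rule mult_le_mono2)
  also have "\<dots> \<le> (6 * m) * (6 * m)" using assms(1) by (intro mult_le_mono)
  finally have "n \<le> m ^ 2" by (simp add: power2_eq_square)
  then have "real n \<le> real m ^ 2" by (metis of_nat_le_iff of_nat_power)
  then have "ln (real n) \<le> ln (real m ^ 2)" using assms(2) by (intro ln_mono) simp_all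
  then show ?thesis using assms by (simp add: ln_realpow)
qed

lemma ln_num_S3_46_gt:
  assumes n: "42 \<le> n"
  shows "1 / 200000 * real n ^ 3 * ln (real n) < ln (real (num_S3_46 (2 * n)))"
proof -
  obtain e where e: "quads_embeddable e (2 * n)" using ex_quads_embeddable[of "2 * n"] n by auto
  define m :: nat where "m = 2 ^ e"
  define j where "j = m ^ 3 div 128"
  have m: "n \<le> 6 * m" "7 \<le> m" using e n by (simp_all add: quads_embeddable_def m_def)
  have "m ^ j \<le> (8 * (m - 1)) ^ j" using m(2) by (intro power_mono) simp_all
  also have "\<dots> \<le> num_S3_46 (2 * n)"
    using num_S3_46_ge[OF e, of j] by (simp add: m_def j_def)
  finally have "real m ^ j \<le> real (num_S3_46 (2 * n))" by (metis of_nat_le_iff of_nat_power)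
  then have "ln (real m ^ j) \<le> ln (real (num_S3_46 (2 * n)))"
    using m(2) by (intro ln_mono) simp_all
  then have ln_num: "real j * ln (real m) \<le> ln (real (num_S3_46 (2 * n)))"
    using m(2) by (simp add: ln_realpow)
  have "0 < ln (real n)" using n by simp
  then have "1 / 200000 * real n ^ 3 * ln (real n) < real n ^ 3 / 55296 * (ln (real n) / 2)"
    using n by simp
  also have "\<dots> \<le> real j * ln (real m)"
    using cube_div_le_cube_div_128[OF m] ln_le_double_ln[OF m(1)] n \<open>0 < ln (real n)\<close>
    unfolding j_def by (intro mult_mono) simp_all
  also note ln_num
  finally show ?thesis .
qed

theorem theorem3:
  shows "\<exists>c::real. c > 0 \<and>
    (\<forall>\<^sub>F n in sequentially. ln (real (num_S3_46 (2 * n))) > c * real n ^ 3 * ln (real n))"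
proof (intro exI conjI)
  show "\<forall>\<^sub>F n in sequentially.
      ln (real (num_S3_46 (2 * n))) > 1 / 200000 * real n ^ 3 * ln (real n)"
    using ln_num_S3_46_gt by (rule eventually_sequentiallyI)
qed simp

end
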